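(* Let $p \geq 3$ be fixed. The edge expansion of the Hanoi graph $H_p^n$ satisfies $h(H_p^n) = \Theta\big(((p-2)/p)^n\big)$ as $n \to \infty$.
   Context: The Tower of Hanoi puzzle has $n$ discs $d_1,\dots,d_n$, with $d_i$ larger than $d_j$ whenever $i>j$, and $p$ pegs $[p]=\{1,\dots,p\}$. A configuration is any function $\tau\colon\{d_1,\dots,d_n\}\to[p]$; since no disc may lie on a smaller disc, each such function determines a unique puzzle state. The Hanoi graph $H_p^n$ has the $p^n$ configurations as vertices, and two configurations are adjacent if and only if one is obtained from the other by a single legal move: the topmost disc of some peg is moved onto another peg whose discs (if any) are all larger than it. For a graph $G=(V,E)$ and $S\subseteq V$, let $\partial S=\{(u,v)\in E : u\in S, v\in V\setminus S\}$. The edge expansion of $G$ is $h(G)=\min\{|\partial S|/|S| : S\subseteq V,\ 0<|S|\le |V|/2\}$. *)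

theory Defs
  imports
    Complex_Main
    "HOL-Library.FuncSet"
    "HOL-Library.Landau_Symbols"
    "Graph_Theory.Pair_Digraph"
begin

text \<open>
  Discs are the numbers \<open>1, \<dots>, n\<close>, ordered by size, and pegs the numbers \<open>1, \<dots>, p\<close>.
  Extensional functions are used so that each configuration is represented exactly once.
\<close>

definition hanoi_configs :: "nat \<Rightarrow> nat \<Rightarrow> (nat \<Rightarrow> nat) set" where
  "hanoi_configs p n = ({1..n} \<rightarrow>\<^sub>E {1..p})"

definition topmost :: "nat \<Rightarrow> (nat \<Rightarrow> nat) \<Rightarrow> nat \<Rightarrow> bool" where
  "topmost n \<tau> d \<longleftrightarrow> d \<in> {1..n} \<and> (\<forall>e\<in>{1..n}. \<tau> e = \<tau> d \<longrightarrow> d \<le> e)"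

definition legal_move :: "nat \<Rightarrow> nat \<Rightarrow> (nat \<Rightarrow> nat) \<Rightarrow> (nat \<Rightarrow> nat) \<Rightarrow> bool" where
  "legal_move p n \<sigma> \<tau> \<longleftrightarrow>
     (\<exists>d\<in>{1..n}. \<exists>q\<in>{1..p}. topmost n \<sigma> d \<and> q \<noteq> \<sigma> d \<and>
        (\<forall>e\<in>{1..n}. \<sigma> e = q \<longrightarrow> d < e) \<and> \<tau> = \<sigma>(d := q))"

text \<open>An undirected graph is represented by its symmetric arc set.\<close>

definition hanoi_graph :: "nat \<Rightarrow> nat \<Rightarrow> (nat \<Rightarrow> nat) pair_pre_digraph" where
  "hanoi_graph p n =
     \<lparr> pverts = hanoi_configs p n,
       parcs = {(\<sigma>, \<tau>). \<sigma> \<in> hanoi_configs p n \<and> \<tau> \<in> hanoi_configs p n \<and>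
                        (legal_move p n \<sigma> \<tau> \<or> legal_move p n \<tau> \<sigma>)} \<rparr>"

text \<open>
  With a symmetric arc set every undirected edge leaving \<open>S\<close> contributes exactly one pair below,
  namely the one directed out of \<open>S\<close>.
\<close>

definition edge_boundary :: "'a pair_pre_digraph \<Rightarrow> 'a set \<Rightarrow> ('a \<times> 'a) set" where
  "edge_boundary G S = {(u, v) \<in> parcs G. u \<in> S \<and> v \<in> pverts G - S}"

text \<open>
  For a finite graph with at least two vertices the minimum is over a finite nonempty set;
  otherwise the value is unspecified.
\<close>

definition edge_expansion :: "'a pair_pre_digraph \<Rightarrow> real" where
  "edge_expansion G =
     Min {real (card (edge_boundary G S)) / real (card S) | S.
            S \<subseteq> pverts G \<and> 0 < card S \<and> real (card S) \<le> real (card (pverts G)) / 2}"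

end

theory Submission
  imports Defs
begin

text \<open>
  Fixing the peg of the largest disc splits the graph into \<open>p\<close> copies of the graph on one disc
  fewer; copies \<open>k\<close> and \<open>l\<close> are joined by a matching on the \<open>(p - 2)\<^sup>m\<close> configurations of the
  \<open>m\<close> smaller discs that avoid the pegs \<open>k\<close> and \<open>l\<close>. Cutting off one copy gives the upper bound.

  For the lower bound, write \<open>B\<^sub>e\<close> for the configurations avoiding both pegs of a pair \<open>e\<close>, and
  consider the demand that ships, for every \<open>e\<close>, weight \<open>w\<^sub>e\<close> from each element of \<open>B\<^sub>e\<close> to the
  uniform distribution. Balancing the copies by a flow of \<open>(deg l - deg k) / p\<close> along each edge from
  copy \<open>k\<close> to copy \<open>l\<close> leaves in copy \<open>k\<close> a demand of the same form, with new weights. A quadratic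
  form in the weights, corrected by the total weight, does not increase in this passage, so the
  recursive flow has bounded congestion. Hence the size of the intersection of any set with two
  copies can only differ by \<open>O((p / (p - 2))\<^sup>m)\<close> times the size of its edge boundary, and summing these
  differences over all levels, a geometric series, bounds \<open>|S| |V - S| / |V|\<close>.
\<close>

section \<open>Configurations, slices and crossing edges\<close>

definition avoiding :: "nat \<Rightarrow> nat \<Rightarrow> nat \<Rightarrow> nat \<Rightarrow> (nat \<Rightarrow> nat) set" where
  "avoiding p m i j = ({1..m} \<rightarrow>\<^sub>E ({1..p} - {i, j}))"

text \<open>The value at \<open>Suc m\<close> is left free here, so a slice becomes a set of
  configurations of \<open>m\<close> discs only after intersecting with
  \<open>hanoi_configs p m\<close> or a subset of it.\<close>

definition slice :: "(nat \<Rightarrow> nat) set \<Rightarrow> nat \<Rightarrow> nat \<Rightarrow> (nat \<Rightarrow> nat) set" where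
  "slice S m k = {\<sigma>. \<sigma>(Suc m := k) \<in> S}"

text \<open>Arcs join configurations only, so just the part of \<open>S\<close> inside
  \<open>hanoi_configs p m\<close> matters, and a \<open>slice\<close> can be inserted as it
  is.\<close>

definition cut :: "nat \<Rightarrow> nat \<Rightarrow> (nat \<Rightarrow> nat) set \<Rightarrow> nat" where
  "cut p m S = card (edge_boundary (hanoi_graph p m) S)"

definition crossing :: "nat \<Rightarrow> nat \<Rightarrow> (nat \<Rightarrow> nat) set \<Rightarrow> nat \<Rightarrow> nat \<Rightarrow> (nat \<Rightarrow> nat) set" where
  "crossing p m S k l = {\<sigma> \<in> avoiding p m k l. \<sigma>(Suc m := k) \<in> S \<and> \<sigma>(Suc m := l) \<notin> S}"

lemma avoiding_commute: "avoiding p m i j = avoiding p m j i"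
  by (simp add: avoiding_def insert_commute)

lemma finite_avoiding [simp]: "finite (avoiding p m i j)"
  by (simp add: avoiding_def finite_PiE)

lemma finite_hanoi_configs [simp]: "finite (hanoi_configs p m)"
  by (simp add: hanoi_configs_def finite_PiE)

lemma card_hanoi_configs: "card (hanoi_configs p m) = p ^ m"
  by (simp add: hanoi_configs_def card_PiE)

lemma card_avoiding:
  assumes "i \<in> {1..p}" "j \<in> {1..p}" "i \<noteq> j"
  shows "card (avoiding p m i j) = (p - 2) ^ m"
proof -
  have "card ({1..p} - {i, j}) = p - 2"
    using assms by (subst card_Diff_subset) auto
  then show ?thesis by (simp add: avoiding_def card_PiE)
qed

lemma avoiding_subset_configs: "avoiding p m i j \<subseteq> hanoi_configs p m"
  unfolding avoiding_def hanoi_configs_def by (rule PiE_mono) auto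

lemma fun_upd_in_configs:
  assumes "\<sigma> \<in> hanoi_configs p m" "k \<in> {1..p}"
  shows "\<sigma>(Suc m := k) \<in> hanoi_configs p (Suc m)"
  using assms by (auto simp: hanoi_configs_def PiE_iff extensional_def le_Suc_eq)

text \<open>Both functions are \<open>undefined\<close> at \<open>Suc m\<close>, so overwriting that
  value loses no information.\<close>

lemma fun_upd_Suc_inject:
  assumes "\<sigma> \<in> hanoi_configs p m" "\<tau> \<in> hanoi_configs p m" "\<sigma>(Suc m := k) = \<tau>(Suc m := l)"
  shows "\<sigma> = \<tau>"
proof
  fix x
  show "\<sigma> x = \<tau> x"
  proof (cases "x = Suc m")
    case True
    then show ?thesis using assms(1,2) by (auto simp: hanoi_configs_def PiE_iff extensional_def)
  next
    case False
    then show ?thesis using fun_cong[OF assms(3), of x] by simp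
  qed
qed

lemma sum_PiE_Suc:
  assumes "finite A"
  shows "(\<Sum>\<sigma>\<in>{1..Suc m} \<rightarrow>\<^sub>E A. f \<sigma>) = (\<Sum>k\<in>A. \<Sum>\<sigma>\<in>{1..m} \<rightarrow>\<^sub>E A. f (\<sigma>(Suc m := k)))"
proof -
  have ins: "{1..Suc m} = insert (Suc m) {1..m}" by auto
  have inj: "inj_on (\<lambda>(y, g). g(Suc m := y)) (A \<times> ({1..m} \<rightarrow>\<^sub>E A))"
    using inj_combinator[of "Suc m" "{1..m}" "\<lambda>_. A"] by simp
  show ?thesis
    unfolding ins PiE_insert_eq
    by (subst sum.reindex[OF inj]) (simp add: sum.cartesian_product case_prod_unfold)
qed

lemma card_Int_eq_sum:
  assumes "finite B"
  shows "real (card (S \<inter> B)) = (\<Sum>\<sigma>\<in>B. of_bool (\<sigma> \<in> S))"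
  using assms by (simp add: of_bool_def sum.If_cases Int_commute Collect_mem_eq)

lemma card_Int_PiE_Suc:
  assumes "finite A"
  shows "real (card (S \<inter> ({1..Suc m} \<rightarrow>\<^sub>E A)))
    = (\<Sum>k\<in>A. real (card (slice S m k \<inter> ({1..m} \<rightarrow>\<^sub>E A))))"
proof -
  have fin: "finite ({1..n} \<rightarrow>\<^sub>E A)" for n :: nat
    using assms by (simp add: finite_PiE)
  show ?thesis
    unfolding card_Int_eq_sum[OF fin] sum_PiE_Suc[OF assms] slice_def mem_Collect_eq ..
qed

lemma card_Int_configs_Suc:
  "real (card (S \<inter> hanoi_configs p (Suc m)))
    = (\<Sum>k\<in>{1..p}. real (card (slice S m k \<inter> hanoi_configs p m)))"
  unfolding hanoi_configs_def by (rule card_Int_PiE_Suc) simp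

lemma card_Int_avoiding_Suc:
  "real (card (S \<inter> avoiding p (Suc m) i j))
    = (\<Sum>k\<in>{1..p} - {i, j}. real (card (slice S m k \<inter> avoiding p m i j)))"
  unfolding avoiding_def by (rule card_Int_PiE_Suc) simp

section \<open>Recursive structure of the edge boundary\<close>

lemma finite_edge_boundary_hanoi [simp]: "finite (edge_boundary (hanoi_graph p m) S)"
  by (rule finite_subset[of _ "hanoi_configs p m \<times> hanoi_configs p m"])
    (auto simp: edge_boundary_def hanoi_graph_def)

text \<open>An additional largest disc never blocks a smaller one.\<close>

lemma legal_move_fun_upd:
  assumes "legal_move p m \<sigma> \<tau>"
  shows "legal_move p (Suc m) (\<sigma>(Suc m := k)) (\<tau>(Suc m := k))"
proof -
  from assms obtain d q where dq: "d \<in> {1..m}" "q \<in> {1..p}" "topmost m \<sigma> d" "q \<noteq> \<sigma> d"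
    "\<forall>e\<in>{1..m}. \<sigma> e = q \<longrightarrow> d < e" "\<tau> = \<sigma>(d := q)"
    unfolding legal_move_def by blast
  show ?thesis
    unfolding legal_move_def topmost_def
  proof (rule bexI[of _ d], rule bexI[of _ q], intro conjI)
    show "\<tau>(Suc m := k) = (\<sigma>(Suc m := k))(d := q)" using dq by (auto simp: fun_upd_twist)
  qed (use dq in \<open>auto simp: topmost_def le_Suc_eq\<close>)
qed

text \<open>All smaller discs are off both pegs: disc \<open>Suc m\<close> is alone on
  \<open>k\<close>, and \<open>l\<close> is empty.\<close>

lemma legal_move_largest:
  assumes "\<sigma> \<in> avoiding p m k l" "l \<in> {1..p}" "k \<noteq> l"
  shows "legal_move p (Suc m) (\<sigma>(Suc m := k)) (\<sigma>(Suc m := l))"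
  unfolding legal_move_def topmost_def
  by (rule bexI[of _ "Suc m"], rule bexI[of _ l], intro conjI)
    (use assms in \<open>auto simp: avoiding_def PiE_iff le_Suc_eq\<close>)

text \<open>An edge inside a copy leaves the largest disc at rest, a crossing edge moves it; both
  kinds embed injectively, with disjoint images, into the boundary of \<open>S\<close>.\<close>

lemma cut_Suc_ge:
  "(\<Sum>k\<in>{1..p}. real (cut p m (slice S m k)))
     + (\<Sum>k\<in>{1..p}. \<Sum>l\<in>{1..p} - {k}. real (card (crossing p m S k l)))
   \<le> real (cut p (Suc m) S)"
proof -
  define E where "E T = edge_boundary (hanoi_graph p m) T" for T
  define I where "I = (SIGMA k:{1..p}. E (slice S m k))"
  define J where "J = (SIGMA kl:(SIGMA k:{1..p}. {1..p} - {k}). crossing p m S (fst kl) (snd kl))"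
  define \<phi> where "\<phi> = (\<lambda>(k, \<sigma>::nat\<Rightarrow>nat, \<tau>::nat\<Rightarrow>nat). (\<sigma>(Suc m := k), \<tau>(Suc m := k)))"
  define \<psi> where "\<psi> = (\<lambda>((k, l), \<sigma>::nat\<Rightarrow>nat). (\<sigma>(Suc m := k), \<sigma>(Suc m := l)))"
  have finC: "finite (crossing p m S k l)" for k l
    by (simp add: crossing_def)
  have finI: "finite I" and finJ: "finite J"
    by (auto simp: I_def J_def E_def finC)
  have cardI: "card I = (\<Sum>k\<in>{1..p}. cut p m (slice S m k))"
    by (simp add: I_def E_def cut_def)
  have cardJ: "card J = (\<Sum>k\<in>{1..p}. \<Sum>l\<in>{1..p} - {k}. card (crossing p m S k l))"
    by (simp add: J_def finC sum.Sigma case_prod_unfold)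
  have Iconf: "\<sigma> \<in> hanoi_configs p m" "\<tau> \<in> hanoi_configs p m" "k \<in> {1..p}"
    if "(k, \<sigma>, \<tau>) \<in> I" for k \<sigma> \<tau>
    using that by (auto simp: I_def E_def edge_boundary_def hanoi_graph_def)
  have Jconf: "\<sigma> \<in> hanoi_configs p m" "k \<in> {1..p}" "l \<in> {1..p}" "k \<noteq> l" "\<sigma> \<in> avoiding p m k l"
    if "((k, l), \<sigma>) \<in> J" for k l \<sigma>
    using that avoiding_subset_configs[of p m k l] by (auto simp: J_def crossing_def)
  have inj\<phi>: "inj_on \<phi> I"
  proof (rule inj_onI)
    fix x x' assume xx: "x \<in> I" "x' \<in> I" "\<phi> x = \<phi> x'"
    obtain k \<sigma> \<tau> k' \<sigma>' \<tau>' where x: "x = (k, \<sigma>, \<tau>)" "x' = (k', \<sigma>', \<tau>')"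
      by (metis prod.exhaust)
    have a: "(k, \<sigma>, \<tau>) \<in> I" "(k', \<sigma>', \<tau>') \<in> I" "\<phi> (k, \<sigma>, \<tau>) = \<phi> (k', \<sigma>', \<tau>')"
      using xx x by simp_all
    from a(3) have e: "\<sigma>(Suc m := k) = \<sigma>'(Suc m := k')" "\<tau>(Suc m := k) = \<tau>'(Suc m := k')"
      by (auto simp: \<phi>_def)
    have "k = k'" using fun_cong[OF e(1), of "Suc m"] by simp
    then show "x = x'"
      using x fun_upd_Suc_inject[OF Iconf(1)[OF a(1)] Iconf(1)[OF a(2)] e(1)]
        fun_upd_Suc_inject[OF Iconf(2)[OF a(1)] Iconf(2)[OF a(2)] e(2)] by simp
  qed
  have inj\<psi>: "inj_on \<psi> J"
  proof (rule inj_onI)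
    fix x x' assume xx: "x \<in> J" "x' \<in> J" "\<psi> x = \<psi> x'"
    obtain k l \<sigma> k' l' \<sigma>' where x: "x = ((k, l), \<sigma>)" "x' = ((k', l'), \<sigma>')"
      by (metis prod.exhaust)
    have a: "((k, l), \<sigma>) \<in> J" "((k', l'), \<sigma>') \<in> J" "\<psi> ((k, l), \<sigma>) = \<psi> ((k', l'), \<sigma>')"
      using xx x by simp_all
    from a(3) have e: "\<sigma>(Suc m := k) = \<sigma>'(Suc m := k')" "\<sigma>(Suc m := l) = \<sigma>'(Suc m := l')"
      by (auto simp: \<psi>_def)
    have "k = k'" "l = l'" using fun_cong[OF e(1), of "Suc m"] fun_cong[OF e(2), of "Suc m"] by auto
    then show "x = x'"
      using x fun_upd_Suc_inject[OF Jconf(1)[OF a(1)] Jconf(1)[OF a(2)] e(1)] by simp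
  qed
  have disj: "\<phi> ` I \<inter> \<psi> ` J = {}"
  proof -
    have "fst x (Suc m) = snd x (Suc m)" if "x \<in> \<phi> ` I" for x
      using that by (auto simp: \<phi>_def)
    moreover have "fst x (Suc m) \<noteq> snd x (Suc m)" if "x \<in> \<psi> ` J" for x
      using that by (auto simp: \<psi>_def dest: Jconf(4))
    ultimately show ?thesis by blast
  qed
  have sub: "\<phi> ` I \<union> \<psi> ` J \<subseteq> edge_boundary (hanoi_graph p (Suc m)) S"
  proof (intro Un_least image_subsetI)
    fix x assume "x \<in> I"
    moreover obtain k \<sigma> \<tau> where x: "x = (k, \<sigma>, \<tau>)" by (cases x)
    ultimately show "\<phi> x \<in> edge_boundary (hanoi_graph p (Suc m)) S"
      by (auto simp: \<phi>_def I_def E_def edge_boundary_def hanoi_graph_def slice_def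
          intro: legal_move_fun_upd fun_upd_in_configs)
  next
    fix x assume xJ: "x \<in> J"
    obtain k l \<sigma> where x: "x = ((k, l), \<sigma>)" by (metis prod.exhaust)
    note c = Jconf[OF xJ[unfolded x]]
    have "legal_move p (Suc m) (\<sigma>(Suc m := k)) (\<sigma>(Suc m := l))"
      using c legal_move_largest by blast
    moreover have "\<sigma>(Suc m := k) \<in> S" "\<sigma>(Suc m := l) \<notin> S"
      using xJ unfolding x by (auto simp: J_def crossing_def)
    ultimately show "\<psi> x \<in> edge_boundary (hanoi_graph p (Suc m)) S"
      using c by (simp add: x \<psi>_def edge_boundary_def hanoi_graph_def fun_upd_in_configs
          del: fun_upd_apply)
  qed
  have "card I + card J = card (\<phi> ` I \<union> \<psi> ` J)"
    using finI finJ disj by (simp add: card_Un_disjoint card_image inj\<phi> inj\<psi>)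
  also have "\<dots> \<le> cut p (Suc m) S"
    unfolding cut_def by (rule card_mono[OF _ sub]) simp
  finally have "real (card I + card J) \<le> real (cut p (Suc m) S)" by (rule of_nat_mono)
  then show ?thesis unfolding cardI cardJ by simp
qed

text \<open>The largest disc can pass between \<open>k\<close> and \<open>l\<close> over any
  configuration in \<open>avoiding p m k l\<close>. One that lies in only one of the two slices
  yields a crossing edge.\<close>

lemma card_slice_diff_le:
  "\<bar>real (card (slice S m k \<inter> avoiding p m k l)) - real (card (slice S m l \<inter> avoiding p m k l))\<bar>
    \<le> real (card (crossing p m S k l)) + real (card (crossing p m S l k))"
proof -
  have le: "card (slice S m k \<inter> avoiding p m k l)
      \<le> card (slice S m l \<inter> avoiding p m k l) + card (crossing p m S k l)" for k l
  proof -
    have "card (slice S m k \<inter> avoiding p m k l)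
        \<le> card ((slice S m l \<inter> avoiding p m k l) \<union> crossing p m S k l)"
      by (rule card_mono) (auto simp: slice_def crossing_def)
    also have "\<dots> \<le> card (slice S m l \<inter> avoiding p m k l) + card (crossing p m S k l)"
      by (rule card_Un_le)
    finally show ?thesis .
  qed
  from le[of k l] le[of l k] show ?thesis
    by (simp add: avoiding_commute[of p m l k])
qed

section \<open>Weights on pairs of pegs, their energy and potential\<close>

locale pegs =
  fixes p :: nat
  assumes p3: "p \<ge> 3"
begin

definition deg :: "(nat \<Rightarrow> nat \<Rightarrow> real) \<Rightarrow> nat \<Rightarrow> real" where
  "deg w i = (\<Sum>j\<in>{1..p}. w i j)"

text \<open>As the sum of the degrees, this counts each unordered pair twice.\<close>

definition mass :: "(nat \<Rightarrow> nat \<Rightarrow> real) \<Rightarrow> real" where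
  "mass w = (\<Sum>i\<in>{1..p}. deg w i)"

text \<open>
  The relative coefficient is chosen so that, when the mass vanishes, passing to a copy changes the
  energy by a negative multiple of the sum of the squared changes of the weights.
\<close>

definition energy :: "(nat \<Rightarrow> nat \<Rightarrow> real) \<Rightarrow> real" where
  "energy w = real p / 2 * (\<Sum>i\<in>{1..p}. \<Sum>j\<in>{1..p}. (w i j)\<^sup>2) + (\<Sum>i\<in>{1..p}. (deg w i)\<^sup>2)"

text \<open>The second term is a correction that pays for the growth of the first: in one
  \<open>step\<close> the square root gains at most \<open>2 * \<bar>mass w\<bar> / p\<close>, and
  the mass term loses exactly this amount.\<close>

definition potential :: "(nat \<Rightarrow> nat \<Rightarrow> real) \<Rightarrow> real" where
  "potential w = sqrt (energy w) + \<bar>mass w\<bar>"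

text \<open>
  The weights of the demand in copy \<open>k\<close>: pairs containing \<open>k\<close> lose their old weight, because no
  configuration with the largest disc on \<open>k\<close> avoids \<open>k\<close>, and receive minus the flow out of copy \<open>k\<close>.
\<close>

definition step :: "nat \<Rightarrow> (nat \<Rightarrow> nat \<Rightarrow> real) \<Rightarrow> nat \<Rightarrow> nat \<Rightarrow> real" where
  "step k w i j =
     (if i = k then (deg w k - deg w j) / p else if j = k then (deg w k - deg w i) / p else w i j)"

text \<open>A weighted graph on the pegs without loops. Loops would bring in the sets
  \<open>avoiding p m i i\<close>, which exclude one peg instead of two.\<close>

definition edge_weight :: "(nat \<Rightarrow> nat \<Rightarrow> real) \<Rightarrow> bool" where
  "edge_weight w \<longleftrightarrow> (\<forall>i j. w i j = w j i) \<and> (\<forall>i. w i i = 0)"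

lemma edge_weight_step: "edge_weight w \<Longrightarrow> edge_weight (step k w)"
  by (auto simp: edge_weight_def step_def)

lemma sum_remove_peg:
  assumes "k \<in> {1..p}"
  shows "(\<Sum>l\<in>{1..p}. f l) = f k + (\<Sum>l\<in>{1..p} - {k}. f l)"
  using assms by (intro sum.remove) auto

text \<open>Separates the row and column through \<open>k\<close>, the only entries that
  \<open>step\<close> changes. Since the diagonal entry vanishes, both arms can be written as a full
  row.\<close>

lemma sum_off_star:
  fixes f :: "nat \<Rightarrow> nat \<Rightarrow> real"
  assumes "k \<in> {1..p}" "\<And>i j. f i j = f j i" "f k k = 0"
  shows "(\<Sum>i\<in>{1..p}. \<Sum>j\<in>{1..p}. f i j)
    = (\<Sum>i\<in>{1..p} - {k}. \<Sum>j\<in>{1..p} - {k}. f i j) + 2 * (\<Sum>j\<in>{1..p}. f k j)"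
proof -
  have row: "(\<Sum>j\<in>{1..p}. f i j) = f i k + (\<Sum>j\<in>{1..p} - {k}. f i j)" for i
    by (rule sum_remove_peg[OF assms(1)])
  have "(\<Sum>i\<in>{1..p}. \<Sum>j\<in>{1..p}. f i j)
      = (\<Sum>j\<in>{1..p}. f k j) + (\<Sum>i\<in>{1..p} - {k}. \<Sum>j\<in>{1..p}. f i j)"
    by (rule sum_remove_peg[OF assms(1)])
  also have "(\<Sum>i\<in>{1..p} - {k}. \<Sum>j\<in>{1..p}. f i j)
      = (\<Sum>i\<in>{1..p} - {k}. f i k) + (\<Sum>i\<in>{1..p} - {k}. \<Sum>j\<in>{1..p} - {k}. f i j)"
    by (simp only: row sum.distrib)
  also have "(\<Sum>i\<in>{1..p} - {k}. f i k) = (\<Sum>j\<in>{1..p} - {k}. f k j)"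
    by (rule sum.cong[OF refl]) (rule assms(2))
  also have "\<dots> = (\<Sum>j\<in>{1..p}. f k j)"
    unfolding row[of k] assms(3) by (rule add_0_left[symmetric])
  finally show ?thesis by linarith
qed

lemma deg_step_self: "deg (step k w) k = deg w k - mass w / p"
  using p3 by (simp add: deg_def[of "step k w"] step_def sum_subtractf mass_def field_simps
      flip: sum_divide_distrib)

lemma deg_step_other:
  assumes "edge_weight w" "k \<in> {1..p}" "l \<noteq> k"
  shows "deg (step k w) l = deg w l + ((deg w k - deg w l) / p - w k l)"
proof -
  have "deg (step k w) l = step k w l k + (\<Sum>j\<in>{1..p} - {k}. step k w l j)"
    unfolding deg_def by (rule sum_remove_peg[OF assms(2)])
  also have "(\<Sum>j\<in>{1..p} - {k}. step k w l j) = (\<Sum>j\<in>{1..p} - {k}. w l j)"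
    using assms(3) by (intro sum.cong) (auto simp: step_def)
  also have "\<dots> = deg w l - w l k"
    unfolding deg_def sum_remove_peg[OF assms(2)] by simp
  also have "w l k = w k l" using assms(1) by (simp add: edge_weight_def)
  also have "step k w l k = (deg w k - deg w l) / p"
    using assms(3) by (simp add: step_def)
  finally show ?thesis by simp
qed

text \<open>The summand is the change of the weight of the pair \<open>k\<close>, \<open>l\<close>.
  The new values add up to \<open>deg w k - mass w / p\<close>, the old ones to
  \<open>deg w k\<close>.\<close>

lemma sum_defect:
  "(\<Sum>l\<in>{1..p}. (deg w k - deg w l) / p - w k l) = - mass w / p"
proof -
  have "(\<Sum>l\<in>{1..p}. (deg w k - deg w l) / p - w k l)
      = (\<Sum>l\<in>{1..p}. deg w k - deg w l) / p - deg w k"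
    by (simp only: sum_subtractf[of _ "w k"] sum_divide_distrib deg_def[of w k, symmetric])
  also have "(\<Sum>l\<in>{1..p}. deg w k - deg w l) = p * deg w k - mass w"
    by (simp add: sum_subtractf mass_def)
  finally show ?thesis using p3 by (simp add: diff_divide_distrib)
qed

text \<open>Peg \<open>k\<close> loses \<open>mass w / p\<close> of its degree, and by
  \<open>sum_defect\<close> so do the other pegs together. The resulting factor is the share of pegs
  outside a given pair.\<close>

lemma mass_step:
  assumes "edge_weight w" "k \<in> {1..p}"
  shows "mass (step k w) = (1 - 2 / p) * mass w"
proof -
  have "mass (step k w) = deg (step k w) k + (\<Sum>l\<in>{1..p} - {k}. deg (step k w) l)"
    unfolding mass_def by (rule sum_remove_peg[OF assms(2)])
  also have "(\<Sum>l\<in>{1..p} - {k}. deg (step k w) l)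
      = (\<Sum>l\<in>{1..p} - {k}. deg w l + ((deg w k - deg w l) / p - w k l))"
    by (rule sum.cong) (use deg_step_other[OF assms] in auto)
  also have "\<dots> = (\<Sum>l\<in>{1..p} - {k}. deg w l)
      + (\<Sum>l\<in>{1..p} - {k}. (deg w k - deg w l) / p - w k l)"
    by (rule sum.distrib)
  also have "(\<Sum>l\<in>{1..p} - {k}. deg w l) = mass w - deg w k"
    unfolding mass_def sum_remove_peg[OF assms(2)] by simp
  also have "(\<Sum>l\<in>{1..p} - {k}. (deg w k - deg w l) / p - w k l) = - mass w / p"
    using sum_defect[of w k] assms(1)
    unfolding sum_remove_peg[OF assms(2)] by (simp add: edge_weight_def)
  finally show ?thesis by (simp add: deg_step_self algebra_simps)
qed

lemma energy_nonneg: "energy w \<ge> 0"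
  by (auto simp: energy_def intro!: add_nonneg_nonneg mult_nonneg_nonneg sum_nonneg)

lemma abs_deg_le:
  assumes "k \<in> {1..p}"
  shows "\<bar>deg w k\<bar> \<le> sqrt (energy w)"
proof (rule real_le_rsqrt)
  have "(deg w k)\<^sup>2 \<le> (\<Sum>i\<in>{1..p}. (deg w i)\<^sup>2)"
    by (rule member_le_sum) (use assms in auto)
  moreover have "0 \<le> real p / 2 * (\<Sum>i\<in>{1..p}. \<Sum>j\<in>{1..p}. (w i j)\<^sup>2)"
    by (auto intro!: mult_nonneg_nonneg sum_nonneg)
  ultimately show "\<bar>deg w k\<bar>\<^sup>2 \<le> energy w" by (simp add: energy_def)
qed

text \<open>Write \<delta> for the change of the weights at \<open>k\<close>. The degree of each
  other peg \<open>l\<close> changes by \<delta> \<open>l\<close> as well, that of \<open>k\<close>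
  by \<open>- mass w / p\<close>, and \<open>sum_defect\<close> evaluates the part linear in
  \<delta>.\<close>

lemma energy_step:
  assumes w: "edge_weight w" and k: "k \<in> {1..p}"
  shows "energy (step k w) = energy w
    - (real p - 1) * (\<Sum>l\<in>{1..p}. ((deg w k - deg w l) / p - w k l)\<^sup>2)
    - 4 * deg w k * mass w / p + (mass w / p)\<^sup>2"
proof -
  define \<delta> where "\<delta> l = (deg w k - deg w l) / p - w k l" for l
  have \<delta>k: "\<delta> k = 0" using w by (simp add: \<delta>_def edge_weight_def)
  have sq: "(\<Sum>i\<in>{1..p}. \<Sum>j\<in>{1..p}. (v i j)\<^sup>2)
      = (\<Sum>i\<in>{1..p} - {k}. \<Sum>j\<in>{1..p} - {k}. (v i j)\<^sup>2) + 2 * (\<Sum>j\<in>{1..p}. (v k j)\<^sup>2)"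
    if "edge_weight v" for v
    using that by (intro sum_off_star[OF k]) (auto simp: edge_weight_def)
  have off: "(\<Sum>i\<in>{1..p} - {k}. \<Sum>j\<in>{1..p} - {k}. (step k w i j)\<^sup>2)
      = (\<Sum>i\<in>{1..p} - {k}. \<Sum>j\<in>{1..p} - {k}. (w i j)\<^sup>2)"
    by (intro sum.cong) (auto simp: step_def)
  have A: "real p / 2 * (\<Sum>i\<in>{1..p}. \<Sum>j\<in>{1..p}. (step k w i j)\<^sup>2)
      - real p / 2 * (\<Sum>i\<in>{1..p}. \<Sum>j\<in>{1..p}. (w i j)\<^sup>2)
      = (\<Sum>l\<in>{1..p}. p * ((step k w k l)\<^sup>2 - (w k l)\<^sup>2))"
    unfolding sq[OF w] sq[OF edge_weight_step[OF w]] off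
    by (simp add: algebra_simps sum_subtractf flip: sum_distrib_left)
  have B: "(\<Sum>i\<in>{1..p}. (deg (step k w) i)\<^sup>2) - (\<Sum>i\<in>{1..p}. (deg w i)\<^sup>2)
      = ((deg w k - mass w / p)\<^sup>2 - (deg w k)\<^sup>2) + (\<Sum>l\<in>{1..p}. (deg w l + \<delta> l)\<^sup>2 - (deg w l)\<^sup>2)"
  proof -
    have "(\<Sum>i\<in>{1..p}. (deg (step k w) i)\<^sup>2)
        = (deg w k - mass w / p)\<^sup>2 + (\<Sum>l\<in>{1..p} - {k}. (deg (step k w) l)\<^sup>2)"
      unfolding sum_remove_peg[OF k] deg_step_self ..
    also have "(\<Sum>l\<in>{1..p} - {k}. (deg (step k w) l)\<^sup>2) = (\<Sum>l\<in>{1..p} - {k}. (deg w l + \<delta> l)\<^sup>2)"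
      unfolding \<delta>_def by (rule sum.cong) (use deg_step_other[OF w k] in auto)
    also have "\<dots> = (\<Sum>l\<in>{1..p}. (deg w l + \<delta> l)\<^sup>2) - (deg w k)\<^sup>2"
      unfolding sum_remove_peg[OF k] \<delta>k by simp
    finally show ?thesis by (simp add: sum_subtractf)
  qed
  \<comment> \<open>The terms \<open>2 * p * a * \<delta> l\<close> cancel because
    \<open>deg w l = deg w k - p * a\<close>. This is the purpose of the factor \<open>p / 2\<close>
    in \<open>energy\<close>, which is doubled here since each entry of the star occurs
    twice.\<close>
  have pt: "p * ((step k w k l)\<^sup>2 - (w k l)\<^sup>2) + ((deg w l + \<delta> l)\<^sup>2 - (deg w l)\<^sup>2)
      = 2 * deg w k * \<delta> l - (real p - 1) * (\<delta> l)\<^sup>2" for l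
  proof -
    define a where "a = (deg w k - deg w l) / p"
    have "step k w k l = a" and v: "w k l = a - \<delta> l" and y: "deg w l = deg w k - p * a"
      using p3 by (auto simp: step_def a_def \<delta>_def)
    then show ?thesis
      unfolding v y by (simp add: power2_eq_square algebra_simps)
  qed
  have "energy (step k w) - energy w = ((deg w k - mass w / p)\<^sup>2 - (deg w k)\<^sup>2)
      + (\<Sum>l\<in>{1..p}. 2 * deg w k * \<delta> l - (real p - 1) * (\<delta> l)\<^sup>2)"
    unfolding pt[symmetric] sum.distrib using A B by (simp add: energy_def)
  also have "(\<Sum>l\<in>{1..p}. 2 * deg w k * \<delta> l - (real p - 1) * (\<delta> l)\<^sup>2)
      = 2 * deg w k * (- mass w / p) - (real p - 1) * (\<Sum>l\<in>{1..p}. (\<delta> l)\<^sup>2)"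
    using sum_defect[of w k] by (simp add: \<delta>_def sum_subtractf flip: sum_distrib_left)
  finally show ?thesis
    by (simp add: \<delta>_def power2_eq_square algebra_simps)
qed

text \<open>With \<open>N\<close> the root of the energy and \<open>z\<close> as below,
  \<open>energy_step\<close> and \<open>abs_deg_le\<close> bound the new energy by
  \<open>N\<^sup>2 + 4 * N * z + z\<^sup>2\<close>, hence its root by \<open>N + 2 * z\<close>,
  while the absolute mass drops by \<open>2 * z\<close>.\<close>

lemma potential_step:
  assumes w: "edge_weight w" and k: "k \<in> {1..p}"
  shows "potential (step k w) \<le> potential w"
proof -
  define N where "N = sqrt (energy w)"
  define z where "z = \<bar>mass w\<bar> / p"
  have z0: "z \<ge> 0" by (simp add: z_def)
  have "energy (step k w) \<le> energy w - 4 * deg w k * mass w / p + (mass w / p)\<^sup>2"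
    using p3 by (simp add: energy_step[OF w k] sum_nonneg)
  also have "\<dots> \<le> N\<^sup>2 + 4 * N * z + z\<^sup>2"
  proof -
    have "- (deg w k * (mass w / p)) \<le> \<bar>deg w k\<bar> * \<bar>mass w / p\<bar>"
      by (metis abs_ge_minus_self abs_mult)
    also have "\<dots> \<le> N * z"
      using abs_deg_le[OF k, of w] unfolding N_def z_def
      by (intro mult_mono) (auto simp: energy_nonneg)
    finally show ?thesis by (simp add: N_def energy_nonneg z_def power_divide)
  qed
  also have "\<dots> \<le> (N + 2 * z)\<^sup>2"
    by (simp add: power2_eq_square algebra_simps)
  finally have "sqrt (energy (step k w)) \<le> N + 2 * z"
    using z0 by (intro real_le_lsqrt) (auto simp: N_def energy_nonneg)
  moreover have "\<bar>mass (step k w)\<bar> = \<bar>mass w\<bar> - 2 * z"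
  proof -
    have "\<bar>1 - 2 / real p\<bar> = 1 - 2 / real p" using p3 by simp
    then show ?thesis
      unfolding mass_step[OF w k] abs_mult z_def by (simp add: left_diff_distrib)
  qed
  ultimately show ?thesis by (simp add: potential_def N_def)
qed

section \<open>The discrepancy of a set is controlled by its cut\<close>

definition ratio :: real where "ratio = (real p - 2) / real p"

text \<open>The demand evaluated on \<open>S\<close>. Every unordered pair of pegs is counted twice.\<close>

definition discrepancy :: "nat \<Rightarrow> (nat \<Rightarrow> nat \<Rightarrow> real) \<Rightarrow> (nat \<Rightarrow> nat) set \<Rightarrow> real" where
  "discrepancy m w S = (\<Sum>i\<in>{1..p}. \<Sum>j\<in>{1..p}. w i j * real (card (S \<inter> avoiding p m i j)))
     - ratio ^ m * mass w * real (card (S \<inter> hanoi_configs p m))"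

text \<open>Sort by the peg \<open>k\<close> of the largest disc. Pairs without \<open>k\<close>
  keep their weights; the pairs with \<open>k\<close> carry the flow between the copies, which
  produces the extra sum. The uniform parts agree because \<open>mass_step\<close> supplies one more
  factor \<open>ratio\<close>.\<close>

lemma discrepancy_Suc:
  assumes w: "edge_weight w"
  shows "(\<Sum>k\<in>{1..p}. discrepancy m (step k w) (slice S m k)) = discrepancy (Suc m) w S
    + (\<Sum>k\<in>{1..p}. \<Sum>l\<in>{1..p}. (deg w k - deg w l) / p *
        (real (card (slice S m k \<inter> avoiding p m k l)) - real (card (slice S m l \<inter> avoiding p m k l))))"
proof -
  define n where "n k i j = real (card (slice S m k \<inter> avoiding p m i j))" for k i j
  define c where "c k = real (card (slice S m k \<inter> hanoi_configs p m))" for k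
  define a where "a k l = (deg w k - deg w l) / p" for k l
  \<comment> \<open>A configuration with the largest disc on \<open>k\<close> avoids no pair
    containing \<open>k\<close>. Extending by zero makes all three sums range over all pegs, so that
    they can be exchanged.\<close>
  define g where "g k i j = (if k = i \<or> k = j then 0 else w i j * n k i j)" for k i j
  have n_commute: "n k i j = n k j i" for k i j
    by (simp add: n_def avoiding_commute)
  have g_off: "(\<Sum>i\<in>{1..p}. \<Sum>j\<in>{1..p}. g k i j)
      = (\<Sum>i\<in>{1..p} - {k}. \<Sum>j\<in>{1..p} - {k}. w i j * n k i j)" if k: "k \<in> {1..p}" for k
  proof -
    have "(\<Sum>i\<in>{1..p}. \<Sum>j\<in>{1..p}. g k i j)
        = (\<Sum>i\<in>{1..p} - {k}. \<Sum>j\<in>{1..p} - {k}. g k i j) + 2 * (\<Sum>j\<in>{1..p}. g k k j)"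
      using w by (intro sum_off_star[OF k]) (auto simp: g_def edge_weight_def n_commute)
    also have "(\<Sum>j\<in>{1..p}. g k k j) = 0" by (simp add: g_def)
    also have "(\<Sum>i\<in>{1..p} - {k}. \<Sum>j\<in>{1..p} - {k}. g k i j)
        = (\<Sum>i\<in>{1..p} - {k}. \<Sum>j\<in>{1..p} - {k}. w i j * n k i j)"
      by (intro sum.cong) (auto simp: g_def)
    finally show ?thesis by simp
  qed
  have main: "(\<Sum>i\<in>{1..p}. \<Sum>j\<in>{1..p}. w i j * real (card (S \<inter> avoiding p (Suc m) i j)))
      = (\<Sum>k\<in>{1..p}. \<Sum>i\<in>{1..p} - {k}. \<Sum>j\<in>{1..p} - {k}. w i j * n k i j)"
  proof -
    have "w i j * real (card (S \<inter> avoiding p (Suc m) i j)) = (\<Sum>k\<in>{1..p}. g k i j)" for i j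
      unfolding card_Int_avoiding_Suc sum_distrib_left n_def[symmetric]
      by (rule sum.mono_neutral_cong_left) (auto simp: g_def)
    then have "(\<Sum>i\<in>{1..p}. \<Sum>j\<in>{1..p}. w i j * real (card (S \<inter> avoiding p (Suc m) i j)))
        = (\<Sum>i\<in>{1..p}. \<Sum>j\<in>{1..p}. \<Sum>k\<in>{1..p}. g k i j)" by simp
    also have "\<dots> = (\<Sum>i\<in>{1..p}. \<Sum>k\<in>{1..p}. \<Sum>j\<in>{1..p}. g k i j)"
      by (intro sum.cong refl sum.swap)
    also have "\<dots> = (\<Sum>k\<in>{1..p}. \<Sum>i\<in>{1..p}. \<Sum>j\<in>{1..p}. g k i j)"
      by (rule sum.swap)
    also have "\<dots> = (\<Sum>k\<in>{1..p}. \<Sum>i\<in>{1..p} - {k}. \<Sum>j\<in>{1..p} - {k}. w i j * n k i j)"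
      by (rule sum.cong[OF refl g_off])
    finally show ?thesis .
  qed
  have piece: "discrepancy m (step k w) (slice S m k)
      = (\<Sum>i\<in>{1..p} - {k}. \<Sum>j\<in>{1..p} - {k}. w i j * n k i j)
        + 2 * (\<Sum>l\<in>{1..p}. a k l * n k k l) - ratio ^ Suc m * mass w * c k"
    if k: "k \<in> {1..p}" for k
  proof -
    have "(\<Sum>i\<in>{1..p}. \<Sum>j\<in>{1..p}. step k w i j * n k i j)
        = (\<Sum>i\<in>{1..p} - {k}. \<Sum>j\<in>{1..p} - {k}. step k w i j * n k i j)
          + 2 * (\<Sum>l\<in>{1..p}. step k w k l * n k k l)"
      using edge_weight_step[OF w, of k]
      by (intro sum_off_star[OF k]) (auto simp: edge_weight_def n_commute)
    also have "(\<Sum>i\<in>{1..p} - {k}. \<Sum>j\<in>{1..p} - {k}. step k w i j * n k i j)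
        = (\<Sum>i\<in>{1..p} - {k}. \<Sum>j\<in>{1..p} - {k}. w i j * n k i j)"
      by (intro sum.cong) (auto simp: step_def)
    also have "(\<Sum>l\<in>{1..p}. step k w k l * n k k l) = (\<Sum>l\<in>{1..p}. a k l * n k k l)"
      by (intro sum.cong) (auto simp: step_def a_def)
    finally have "(\<Sum>i\<in>{1..p}. \<Sum>j\<in>{1..p}. step k w i j * n k i j)
      = (\<Sum>i\<in>{1..p} - {k}. \<Sum>j\<in>{1..p} - {k}. w i j * n k i j)
        + 2 * (\<Sum>l\<in>{1..p}. a k l * n k k l)" .
    moreover have "ratio ^ m * mass (step k w) = ratio ^ Suc m * mass w"
      using p3 by (simp add: mass_step[OF w k] ratio_def diff_divide_distrib)
    ultimately show ?thesis
      unfolding discrepancy_def n_def[symmetric] c_def[symmetric] by simp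
  qed
  \<comment> \<open>Exchanging \<open>k\<close> and \<open>l\<close> flips the sign of the flow but
    keeps the set \<open>avoiding p m k l\<close>, so one of the two copies of the sum may be
    counted in slice \<open>l\<close>.\<close>
  have anti: "2 * (\<Sum>k\<in>{1..p}. \<Sum>l\<in>{1..p}. a k l * n k k l)
      = (\<Sum>k\<in>{1..p}. \<Sum>l\<in>{1..p}. a k l * (n k k l - n l k l))"
  proof -
    have "(\<Sum>k\<in>{1..p}. \<Sum>l\<in>{1..p}. a k l * n l k l) = (\<Sum>l\<in>{1..p}. \<Sum>k\<in>{1..p}. a k l * n l k l)"
      by (rule sum.swap)
    also have "\<dots> = (\<Sum>l\<in>{1..p}. \<Sum>k\<in>{1..p}. - (a l k * n l l k))"
    proof (intro sum.cong refl)
      fix k l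
      have "a k l = - a l k" by (simp add: a_def minus_divide_left)
      then show "a k l * n l k l = - (a l k * n l l k)" by (simp add: n_commute[of l k l])
    qed
    also have "\<dots> = - (\<Sum>l\<in>{1..p}. \<Sum>k\<in>{1..p}. a l k * n l l k)"
      by (simp add: sum_negf)
    finally show ?thesis by (simp add: right_diff_distrib sum_subtractf)
  qed
  have "(\<Sum>k\<in>{1..p}. discrepancy m (step k w) (slice S m k))
      = (\<Sum>k\<in>{1..p}. (\<Sum>i\<in>{1..p} - {k}. \<Sum>j\<in>{1..p} - {k}. w i j * n k i j)
        + 2 * (\<Sum>l\<in>{1..p}. a k l * n k k l) - ratio ^ Suc m * mass w * c k)"
    by (rule sum.cong[OF refl piece])
  also have "\<dots> = (\<Sum>k\<in>{1..p}. \<Sum>i\<in>{1..p} - {k}. \<Sum>j\<in>{1..p} - {k}. w i j * n k i j)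
        + 2 * (\<Sum>k\<in>{1..p}. \<Sum>l\<in>{1..p}. a k l * n k k l) - ratio ^ Suc m * mass w * (\<Sum>k\<in>{1..p}. c k)"
    unfolding sum_subtractf sum.distrib sum_distrib_left ..
  also have "\<dots> = discrepancy (Suc m) w S + 2 * (\<Sum>k\<in>{1..p}. \<Sum>l\<in>{1..p}. a k l * n k k l)"
    unfolding discrepancy_def main c_def card_Int_configs_Suc by simp
  finally show ?thesis unfolding anti unfolding a_def n_def .
qed

lemma potential_nonneg: "potential w \<ge> 0"
  by (simp add: potential_def energy_nonneg)

text \<open>Induction over the discs, for all weights and sets at once, since the copies carry new
  weights and slices. The potential does not grow, so one constant serves all levels, and
  \<open>cut_Suc_ge\<close> adds up the edges used.\<close>

lemma discrepancy_le_cut: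
  assumes "edge_weight w"
  shows "\<bar>discrepancy m w S\<bar> \<le> 2 * potential w * real (cut p m S)"
  using assms
proof (induction m arbitrary: w S)
  case 0
  \<comment> \<open>The only configuration of no discs avoids every pair, so both parts
    coincide.\<close>
  have "discrepancy 0 w S = 0"
    by (simp add: discrepancy_def avoiding_def hanoi_configs_def mass_def deg_def sum_distrib_right)
  then show ?case by (simp add: potential_nonneg)
next
  case (Suc m)
  define x where "x k l = real (card (crossing p m S k l))" for k l
  define d where "d k l = (deg w k - deg w l) / p * (real (card (slice S m k \<inter> avoiding p m k l))
      - real (card (slice S m l \<inter> avoiding p m k l)))" for k l
  have pieces: "\<bar>discrepancy m (step k w) (slice S m k)\<bar>
      \<le> 2 * potential w * real (cut p m (slice S m k))" if "k \<in> {1..p}" for k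
  proof -
    have "\<bar>discrepancy m (step k w) (slice S m k)\<bar>
        \<le> 2 * potential (step k w) * real (cut p m (slice S m k))"
      by (rule Suc.IH[OF edge_weight_step[OF Suc.prems]])
    also have "\<dots> \<le> 2 * potential w * real (cut p m (slice S m k))"
      using potential_step[OF Suc.prems that] by (intro mult_right_mono) auto
    finally show ?thesis .
  qed
  have x_diag: "x k k = 0" for k
    by (simp add: x_def crossing_def)
  \<comment> \<open>Flow values are at most \<open>2 * potential w / p\<close>, and \<open>p\<close>
    is at least 2.\<close>
  have d_le: "\<bar>d k l\<bar> \<le> potential w * (x k l + x l k)" if "k \<in> {1..p}" "l \<in> {1..p}" for k l
  proof -
    have "\<bar>deg w k - deg w l\<bar> \<le> 2 * potential w"
      using abs_deg_le[OF that(1), of w] abs_deg_le[OF that(2), of w]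
        abs_triangle_ineq4[of "deg w k" "deg w l"]
      unfolding potential_def by (smt (verit) abs_ge_zero)
    also have "\<dots> \<le> real p * potential w"
      using p3 potential_nonneg by (intro mult_right_mono) auto
    finally have "\<bar>(deg w k - deg w l) / p\<bar> \<le> potential w"
      using p3 by (simp add: field_simps)
    then show ?thesis
      unfolding d_def x_def abs_mult
      by (intro mult_mono card_slice_diff_le) (auto simp: potential_nonneg)
  qed
  have "\<bar>discrepancy (Suc m) w S\<bar>
      = \<bar>(\<Sum>k\<in>{1..p}. discrepancy m (step k w) (slice S m k)) - (\<Sum>k\<in>{1..p}. \<Sum>l\<in>{1..p}. d k l)\<bar>"
    unfolding discrepancy_Suc[OF Suc.prems] d_def by simp
  also have "\<dots> \<le> (\<Sum>k\<in>{1..p}. \<bar>discrepancy m (step k w) (slice S m k)\<bar>)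
      + (\<Sum>k\<in>{1..p}. \<Sum>l\<in>{1..p}. \<bar>d k l\<bar>)"
  proof -
    have "\<bar>\<Sum>k\<in>{1..p}. discrepancy m (step k w) (slice S m k)\<bar>
        \<le> (\<Sum>k\<in>{1..p}. \<bar>discrepancy m (step k w) (slice S m k)\<bar>)"
      by (rule sum_abs)
    moreover have "\<bar>\<Sum>k\<in>{1..p}. \<Sum>l\<in>{1..p}. d k l\<bar> \<le> (\<Sum>k\<in>{1..p}. \<Sum>l\<in>{1..p}. \<bar>d k l\<bar>)"
      by (intro order_trans[OF sum_abs] sum_mono sum_abs)
    ultimately show ?thesis by linarith
  qed
  also have "\<dots> \<le> (\<Sum>k\<in>{1..p}. 2 * potential w * real (cut p m (slice S m k)))
      + (\<Sum>k\<in>{1..p}. \<Sum>l\<in>{1..p}. potential w * (x k l + x l k))"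
    by (intro add_mono sum_mono pieces d_le)
  \<comment> \<open>Over ordered pairs each crossing count occurs twice, whence the factor 2 in the
    claim.\<close>
  also have "(\<Sum>k\<in>{1..p}. \<Sum>l\<in>{1..p}. potential w * (x k l + x l k))
      = 2 * potential w * (\<Sum>k\<in>{1..p}. \<Sum>l\<in>{1..p}. x k l)"
    using sum.swap[of "\<lambda>k l. x l k" "{1..p}" "{1..p}"]
    by (simp add: sum.distrib flip: sum_distrib_left)
  also have "(\<Sum>k\<in>{1..p}. \<Sum>l\<in>{1..p}. x k l) = (\<Sum>k\<in>{1..p}. \<Sum>l\<in>{1..p} - {k}. x k l)"
  proof (rule sum.cong[OF refl])
    fix k assume "k \<in> {1..p}"
    then show "(\<Sum>l\<in>{1..p}. x k l) = (\<Sum>l\<in>{1..p} - {k}. x k l)"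
      by (simp only: sum_remove_peg x_diag)
  qed
  also have "(\<Sum>k\<in>{1..p}. 2 * potential w * real (cut p m (slice S m k)))
      + 2 * potential w * (\<Sum>k\<in>{1..p}. \<Sum>l\<in>{1..p} - {k}. x k l)
      = 2 * potential w * ((\<Sum>k\<in>{1..p}. real (cut p m (slice S m k)))
        + (\<Sum>k\<in>{1..p}. \<Sum>l\<in>{1..p} - {k}. x k l))"
    by (simp add: algebra_simps sum_distrib_left)
  also have "\<dots> \<le> 2 * potential w * real (cut p (Suc m) S)"
    unfolding x_def using potential_nonneg by (intro mult_left_mono cut_Suc_ge) auto
  finally show ?case .
qed

section \<open>Equidistribution within and between copies\<close>

definition bound :: real where "bound = sqrt (real p + 2) + 2"

text \<open>Apply \<open>discrepancy_le_cut\<close> to the indicator of the pair in both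
  orientations. Its energy is \<open>p + 2\<close> and its mass 2, so its potential is
  \<open>bound\<close>; the discrepancy is twice the difference on the left.\<close>

lemma avoiding_density:
  assumes ij: "i \<in> {1..p}" "j \<in> {1..p}" "i \<noteq> j"
  shows "\<bar>real (card (S \<inter> avoiding p m i j)) - ratio ^ m * real (card (S \<inter> hanoi_configs p m))\<bar>
    \<le> bound * real (cut p m S)"
proof -
  define w :: "nat \<Rightarrow> nat \<Rightarrow> real" where "w a b = of_bool (a = i \<and> b = j) + of_bool (a = j \<and> b = i)" for a b
  have w: "edge_weight w" using ij by (auto simp: edge_weight_def w_def)
  have sum_w: "(\<Sum>a\<in>{1..p}. \<Sum>b\<in>{1..p}. w a b * f a b) = f i j + f j i" for f
  proof -
    have "(\<Sum>b\<in>{1..p}. w a b * f a b) = of_bool (a = i) * f a j + of_bool (a = j) * f a i" for a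
    proof -
      have "(\<Sum>b\<in>{1..p}. w a b * f a b)
        = (\<Sum>b\<in>{1..p}. (if b = j then of_bool (a = i) * f a j else 0)
            + (if b = i then of_bool (a = j) * f a i else 0))"
        by (intro sum.cong) (auto simp: w_def)
      then show ?thesis using ij by (simp add: sum.distrib)
    qed
    then have "(\<Sum>a\<in>{1..p}. \<Sum>b\<in>{1..p}. w a b * f a b)
        = (\<Sum>a\<in>{1..p}. (if a = i then f i j else 0) + (if a = j then f j i else 0))"
      by (auto intro!: sum.cong)
    then show ?thesis using ij by (simp add: sum.distrib)
  qed
  have deg_w: "deg w a = of_bool (a = i) + of_bool (a = j)" for a
  proof -
    have "deg w a = (\<Sum>b\<in>{1..p}. (if b = j then of_bool (a = i) else 0)
        + (if b = i then of_bool (a = j) else 0))"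
      unfolding deg_def by (intro sum.cong) (auto simp: w_def)
    then show ?thesis using ij by (simp add: sum.distrib)
  qed
  have mass_w: "mass w = 2"
    using sum_w[of "\<lambda>_ _. 1"] by (simp add: mass_def deg_def)
  have "(w a b)\<^sup>2 = w a b * 1" for a b
    using ij by (auto simp: w_def)
  then have sq: "(\<Sum>a\<in>{1..p}. \<Sum>b\<in>{1..p}. (w a b)\<^sup>2) = 2"
    using sum_w[of "\<lambda>_ _. 1"] by simp
  have "(deg w a)\<^sup>2 = (if a = i then 1 else 0) + (if a = j then 1 else 0)" for a
    using ij by (auto simp: deg_w)
  then have "(\<Sum>a\<in>{1..p}. (deg w a)\<^sup>2) = 2"
    using ij by (simp add: sum.distrib)
  then have "potential w = bound"
    unfolding potential_def energy_def sq mass_w bound_def by simp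
  moreover have "discrepancy m w S = 2 * (real (card (S \<inter> avoiding p m i j))
      - ratio ^ m * real (card (S \<inter> hanoi_configs p m)))"
    unfolding discrepancy_def sum_w mass_w avoiding_commute[of p m j i] by simp
  ultimately show ?thesis
    using discrepancy_le_cut[OF w, of m S] by (simp add: abs_mult)
qed

lemma bound_ge_1: "bound \<ge> 1"
proof -
  have "sqrt (real p + 2) \<ge> 0" by simp
  then show ?thesis unfolding bound_def by linarith
qed

text \<open>Both slices are compared on \<open>avoiding p m i j\<close>: by
  \<open>avoiding_density\<close> each has there its proportional share up to its own cut, and the
  two shares differ by at most the crossing edges between \<open>i\<close> and \<open>j\<close>. All
  these edges lie in the boundary of \<open>S\<close>.\<close>

lemma slice_balance:
  assumes ij: "i \<in> {1..p}" "j \<in> {1..p}"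
  shows "ratio ^ m * \<bar>real (card (slice S m i \<inter> hanoi_configs p m))
      - real (card (slice S m j \<inter> hanoi_configs p m))\<bar> \<le> bound * real (cut p (Suc m) S)"
proof (cases "i = j")
  case True
  then show ?thesis using bound_ge_1 by simp
next
  case False
  define b where "b k = real (cut p m (slice S m k))" for k
  define x where "x k l = real (card (crossing p m S k l))" for k l
  have nn: "b k \<ge> 0" "x k l \<ge> 0" for k l by (simp_all add: b_def x_def)
  have two: "f i + f j \<le> (\<Sum>k\<in>{1..p}. f k)" if "\<And>k. f k \<ge> 0" for f :: "nat \<Rightarrow> real"
  proof -
    have "f i + f j = (\<Sum>k\<in>{i, j}. f k)" using False by simp
    also have "\<dots> \<le> (\<Sum>k\<in>{1..p}. f k)" using ij that by (intro sum_mono2) auto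
    finally show ?thesis .
  qed
  have one: "x k l \<le> (\<Sum>l\<in>{1..p} - {k}. x k l)" if "l \<in> {1..p} - {k}" for k l
    using that nn by (intro member_le_sum) auto
  have "x i j + x j i \<le> (\<Sum>l\<in>{1..p} - {i}. x i l) + (\<Sum>l\<in>{1..p} - {j}. x j l)"
    using one[of j i] one[of i j] ij False by auto
  also have "\<dots> \<le> (\<Sum>k\<in>{1..p}. \<Sum>l\<in>{1..p} - {k}. x k l)"
    by (rule two) (simp add: nn sum_nonneg)
  finally have "b i + b j + (x i j + x j i)
      \<le> (\<Sum>k\<in>{1..p}. b k) + (\<Sum>k\<in>{1..p}. \<Sum>l\<in>{1..p} - {k}. x k l)"
    using two[of b, OF nn(1)] by linarith
  also have "\<dots> \<le> real (cut p (Suc m) S)"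
    unfolding b_def x_def by (rule cut_Suc_ge)
  finally have tot: "b i + b j + (x i j + x j i) \<le> real (cut p (Suc m) S)" .
  have "ratio ^ m * \<bar>real (card (slice S m i \<inter> hanoi_configs p m))
      - real (card (slice S m j \<inter> hanoi_configs p m))\<bar>
      = \<bar>ratio ^ m * real (card (slice S m i \<inter> hanoi_configs p m))
      - ratio ^ m * real (card (slice S m j \<inter> hanoi_configs p m))\<bar>"
    using p3 by (simp add: ratio_def abs_mult flip: right_diff_distrib)
  also have "\<dots> \<le> bound * b i + bound * b j + (x i j + x j i)"
    using avoiding_density[OF ij False, of "slice S m i" m] avoiding_density[OF ij False, of "slice S m j" m]
      card_slice_diff_le[of S m i p j] unfolding b_def x_def by linarith
  also have "\<dots> \<le> bound * (b i + b j + (x i j + x j i))"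
    using mult_right_mono[OF bound_ge_1, of "x i j + x j i"] nn by (simp add: algebra_simps)
  also have "\<dots> \<le> bound * real (cut p (Suc m) S)"
    using tot bound_ge_1 by (intro mult_left_mono) auto
  finally show ?thesis .
qed

section \<open>Isoperimetric inequality by summation over the levels\<close>

definition expansion_const :: real where "expansion_const = real p * (real p - 2) / 4 * bound"

lemma expansion_const_pos: "expansion_const > 0"
  using p3 bound_ge_1 by (simp add: expansion_const_def)

text \<open>A variance decomposition: for slice sizes \<open>s k\<close> in copies of size
  \<open>q\<close>, the product of a set and its complement splits into the products inside the
  copies and the spread of the slice sizes.\<close>

lemma sum_mult_sum_diff:
  fixes s :: "nat \<Rightarrow> real"
  shows "(\<Sum>k\<in>{1..p}. s k) * (real p * q - (\<Sum>k\<in>{1..p}. s k))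
    = real p * (\<Sum>k\<in>{1..p}. s k * (q - s k)) + (\<Sum>k\<in>{1..p}. \<Sum>l\<in>{1..p}. (s k - s l)\<^sup>2) / 2"
proof -
  define A where "A = (\<Sum>k\<in>{1..p}. s k)"
  define B where "B = (\<Sum>k\<in>{1..p}. (s k)\<^sup>2)"
  have "(\<Sum>k\<in>{1..p}. \<Sum>l\<in>{1..p}. (s k - s l)\<^sup>2)
      = (\<Sum>k\<in>{1..p}. \<Sum>l\<in>{1..p}. (s k)\<^sup>2 + (s l)\<^sup>2 - 2 * (s k * s l))"
    by (simp add: power2_diff mult.assoc)
  also have "\<dots> = 2 * real p * B - 2 * (A * A)"
    unfolding A_def B_def
    by (simp add: sum_subtractf sum.distrib sum_product flip: sum_distrib_left)
  finally have 1: "(\<Sum>k\<in>{1..p}. \<Sum>l\<in>{1..p}. (s k - s l)\<^sup>2) = 2 * real p * B - 2 * (A * A)" .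
  have "(\<Sum>k\<in>{1..p}. s k * (q - s k)) = (\<Sum>k\<in>{1..p}. s k * q - (s k)\<^sup>2)"
    by (simp add: right_diff_distrib power2_eq_square)
  also have "\<dots> = A * q - B"
    unfolding A_def B_def sum_subtractf sum_distrib_right ..
  finally have 2: "(\<Sum>k\<in>{1..p}. s k * (q - s k)) = A * q - B" .
  show ?thesis unfolding 1 2 A_def[symmetric] by (simp add: field_simps)
qed

text \<open>Induction along \<open>sum_mult_sum_diff\<close>: the products inside the copies fall to
  the induction hypothesis, the spread to \<open>slice_balance\<close>.\<close>

lemma product_le_cut:
  "ratio ^ n * (real (card (S \<inter> hanoi_configs p n))
      * (real p ^ n - real (card (S \<inter> hanoi_configs p n))))
    \<le> expansion_const * real p ^ n * real (cut p n S)"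
proof (induction n arbitrary: S)
  case 0
  have "card (S \<inter> hanoi_configs p 0) \<le> 1"
    using card_mono[of "hanoi_configs p 0" "S \<inter> hanoi_configs p 0"] card_hanoi_configs[of p 0] by simp
  then have "card (S \<inter> hanoi_configs p 0) = 0 \<or> card (S \<inter> hanoi_configs p 0) = 1" by linarith
  then show ?case using expansion_const_pos by auto
next
  case (Suc m)
  define s where "s k = real (card (slice S m k \<inter> hanoi_configs p m))" for k
  define q where "q = real p ^ m"
  define C where "C = real (cut p (Suc m) S)"
  have ratio: "ratio > 0" "ratio = 1 - 2 / p"
    using p3 by (simp_all add: ratio_def diff_divide_distrib)
  have q: "q > 0" using p3 by (simp add: q_def)
  have s: "0 \<le> s k" "s k \<le> q" for k
  proof -
    have "card (slice S m k \<inter> hanoi_configs p m) \<le> p ^ m"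
      unfolding card_hanoi_configs[symmetric] by (rule card_mono) auto
    then show "s k \<le> q" unfolding s_def q_def by (metis of_nat_le_iff of_nat_power)
  qed (simp add: s_def)
  have part1: "(\<Sum>k\<in>{1..p}. ratio ^ m * (s k * (q - s k))) \<le> expansion_const * q * C"
  proof -
    have "(\<Sum>k\<in>{1..p}. ratio ^ m * (s k * (q - s k)))
        \<le> (\<Sum>k\<in>{1..p}. expansion_const * q * real (cut p m (slice S m k)))"
      unfolding s_def q_def by (intro sum_mono Suc.IH)
    also have "\<dots> = expansion_const * q * (\<Sum>k\<in>{1..p}. real (cut p m (slice S m k)))"
      by (simp add: sum_distrib_left)
    also have "\<dots> \<le> expansion_const * q * C"
    proof (rule mult_left_mono)
      have "(\<Sum>k\<in>{1..p}. \<Sum>l\<in>{1..p} - {k}. real (card (crossing p m S k l))) \<ge> 0"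
        by (intro sum_nonneg) auto
      then show "(\<Sum>k\<in>{1..p}. real (cut p m (slice S m k))) \<le> C"
        using cut_Suc_ge[of p m S] unfolding C_def by linarith
      show "expansion_const * q \<ge> 0" using expansion_const_pos q by simp
    qed
    finally show ?thesis .
  qed
  have part2: "(\<Sum>k\<in>{1..p}. \<Sum>l\<in>{1..p}. ratio ^ m * (s k - s l)\<^sup>2) \<le> real p * real p * (q * (bound * C))"
  proof -
    \<comment> \<open>One factor of the square is bounded by the size of a copy, the other by
      \<open>slice_balance\<close>.\<close>
    have "ratio ^ m * (s k - s l)\<^sup>2 \<le> q * (bound * C)" if "k \<in> {1..p}" "l \<in> {1..p}" for k l
    proof -
      have "\<bar>s k - s l\<bar> \<le> q" using s[of k] s[of l] by linarith
      then have "\<bar>s k - s l\<bar> * (ratio ^ m * \<bar>s k - s l\<bar>) \<le> q * (bound * C)"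
      proof (rule mult_mono)
        show "ratio ^ m * \<bar>s k - s l\<bar> \<le> bound * C"
          unfolding s_def C_def by (rule slice_balance[OF that])
      qed (use q ratio(1) in auto)
      moreover have "ratio ^ m * (s k - s l)\<^sup>2 = \<bar>s k - s l\<bar> * (ratio ^ m * \<bar>s k - s l\<bar>)"
        by (metis abs_mult_self_eq mult.left_commute power2_eq_square)
      ultimately show ?thesis by linarith
    qed
    then have "(\<Sum>k\<in>{1..p}. \<Sum>l\<in>{1..p}. ratio ^ m * (s k - s l)\<^sup>2)
        \<le> (\<Sum>k\<in>{1..p}. \<Sum>l\<in>{1..p}. q * (bound * C))"
      by (intro sum_mono)
    then show ?thesis by (simp add: mult.assoc)
  qed
  have "ratio ^ Suc m * ((\<Sum>k\<in>{1..p}. s k) * (real p * q - (\<Sum>k\<in>{1..p}. s k)))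
      = ratio * (real p * (\<Sum>k\<in>{1..p}. ratio ^ m * (s k * (q - s k)))
        + (\<Sum>k\<in>{1..p}. \<Sum>l\<in>{1..p}. ratio ^ m * (s k - s l)\<^sup>2) / 2)"
  proof -
    define X where "X = (\<Sum>k\<in>{1..p}. s k * (q - s k))"
    define Y where "Y = (\<Sum>k\<in>{1..p}. \<Sum>l\<in>{1..p}. (s k - s l)\<^sup>2)"
    show ?thesis
      unfolding sum_mult_sum_diff sum_distrib_left[symmetric] X_def[symmetric] Y_def[symmetric]
      by (simp add: algebra_simps)
  qed
  also have "\<dots> \<le> ratio * (real p * (expansion_const * q * C) + real p * real p * (q * (bound * C)) / 2)"
    using part1 part2 ratio by (intro mult_left_mono add_mono divide_right_mono) auto
  also have "\<dots> = expansion_const * (real p * q) * C"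
  proof -
    \<comment> \<open>The constant is chosen as the fixed point of this recursion, the value of the
      geometric series over all levels; note \<open>1 - ratio = 2 / p\<close>.\<close>
    have "ratio * (expansion_const + real p * bound / 2) = expansion_const"
      using p3 unfolding ratio expansion_const_def by (simp add: field_simps)
    then have "ratio * (expansion_const + real p * bound / 2) * (real p * q * C)
        = expansion_const * (real p * q * C)" by simp
    then show ?thesis by (simp add: algebra_simps)
  qed
  finally show ?case
    unfolding card_Int_configs_Suc s_def C_def q_def by simp
qed

text \<open>The complement of \<open>S\<close> has at least \<open>p ^ n / 2\<close> elements, which
  costs the factor 2.\<close>

lemma cut_ge:
  assumes "S \<subseteq> hanoi_configs p n" "real (card S) \<le> real (card (hanoi_configs p n)) / 2"
  shows "ratio ^ n * real (card S) \<le> 2 * expansion_const * real (cut p n S)"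
proof -
  have pn: "real p ^ n > 0" using p3 by simp
  have S: "S \<inter> hanoi_configs p n = S" using assms(1) by auto
  have "ratio ^ n * (real (card S) * (real p ^ n / 2))
      \<le> ratio ^ n * (real (card S) * (real p ^ n - real (card S)))"
    using assms(2) p3 by (intro mult_left_mono) (auto simp: card_hanoi_configs ratio_def)
  also have "\<dots> \<le> expansion_const * real p ^ n * real (cut p n S)"
    using product_le_cut[of n S] unfolding S .
  finally have "(ratio ^ n * real (card S)) * real p ^ n
      \<le> (2 * expansion_const * real (cut p n S)) * real p ^ n"
    by (simp add: algebra_simps)
  then show ?thesis using pn by (simp only: mult_le_cancel_right_pos)
qed

section \<open>Upper bound from a single copy, and the two-sided estimate\<close>

definition top_set :: "nat \<Rightarrow> (nat \<Rightarrow> nat) set" where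
  "top_set m = {\<sigma> \<in> hanoi_configs p (Suc m). \<sigma> (Suc m) = 1}"

lemma card_top_set: "card (top_set m) = p ^ m"
proof -
  have "top_set m = (\<lambda>\<sigma>. \<sigma>(Suc m := 1)) ` hanoi_configs p m"
  proof (intro equalityI subsetI)
    fix \<sigma> assume a: "\<sigma> \<in> top_set m"
    then have mem: "\<sigma>(Suc m := undefined) \<in> hanoi_configs p m"
      by (auto simp: top_set_def hanoi_configs_def PiE_iff extensional_def)
    have eq: "\<sigma> = (\<sigma>(Suc m := undefined))(Suc m := 1)"
      unfolding fun_upd_upd using a by (intro fun_upd_idem[symmetric]) (simp add: top_set_def)
    show "\<sigma> \<in> (\<lambda>\<sigma>. \<sigma>(Suc m := 1)) ` hanoi_configs p m"
      by (rule image_eqI[where f = "\<lambda>\<sigma>. \<sigma>(Suc m := 1)", OF eq mem])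
  next
    fix \<sigma> assume "\<sigma> \<in> (\<lambda>\<sigma>. \<sigma>(Suc m := 1)) ` hanoi_configs p m"
    then obtain \<tau> where "\<tau> \<in> hanoi_configs p m" "\<sigma> = \<tau>(Suc m := 1)" by (rule imageE)
    then show "\<sigma> \<in> top_set m"
      using p3 fun_upd_in_configs[of \<tau> p m 1] by (simp add: top_set_def)
  qed
  moreover have "inj_on (\<lambda>\<sigma>. \<sigma>(Suc m := 1)) (hanoi_configs p m)"
    by (rule inj_onI) (rule fun_upd_Suc_inject)
  ultimately show ?thesis by (simp add: card_image card_hanoi_configs)
qed

text \<open>Only the moved disc changes its peg, so it is the largest one. It is topmost and may be
  placed on its target, so no smaller disc lies on either peg.\<close>

lemma legal_move_largestD:
  assumes "legal_move p (Suc m) \<sigma> \<tau>" "\<sigma> (Suc m) \<noteq> \<tau> (Suc m)" "\<sigma> \<in> hanoi_configs p (Suc m)"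
  shows "\<sigma>(Suc m := undefined) \<in> avoiding p m (\<sigma> (Suc m)) (\<tau> (Suc m))"
    and "\<tau> = \<sigma>(Suc m := \<tau> (Suc m))"
proof -
  from assms(1) obtain d q where dq: "topmost (Suc m) \<sigma> d"
    "\<forall>e\<in>{1..Suc m}. \<sigma> e = q \<longrightarrow> d < e" "\<tau> = \<sigma>(d := q)"
    unfolding legal_move_def by blast
  have d: "d = Suc m" using assms(2) dq(3) by (metis fun_upd_other)
  have q: "q = \<tau> (Suc m)" using dq(3) d by simp
  show "\<tau> = \<sigma>(Suc m := \<tau> (Suc m))"
    using dq(3) d q by metis
  have "\<sigma> e \<noteq> \<sigma> (Suc m)" "\<sigma> e \<noteq> \<tau> (Suc m)" if "e \<in> {1..m}" for e
    using dq(1,2) that unfolding d q topmost_def by force+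
  then show "\<sigma>(Suc m := undefined) \<in> avoiding p m (\<sigma> (Suc m)) (\<tau> (Suc m))"
    using assms(3) by (auto simp: avoiding_def hanoi_configs_def PiE_iff extensional_def)
qed

text \<open>Every boundary edge takes the largest disc from peg 1 to one of the \<open>p - 1\<close>
  other pegs, with the smaller discs off both.\<close>

lemma cut_top_set: "cut p (Suc m) (top_set m) \<le> (p - 1) * (p - 2) ^ m"
proof -
  define A where "A = (SIGMA l:{2..p}. avoiding p m 1 l)"
  define \<psi> where "\<psi> = (\<lambda>(l, \<sigma>::nat\<Rightarrow>nat). (\<sigma>(Suc m := 1), \<sigma>(Suc m := l)))"
  have "edge_boundary (hanoi_graph p (Suc m)) (top_set m) \<subseteq> \<psi> ` A"
  proof
    fix x assume "x \<in> edge_boundary (hanoi_graph p (Suc m)) (top_set m)"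
    moreover obtain u v where x: "x = (u, v)" by (cases x)
    ultimately have uv: "u \<in> hanoi_configs p (Suc m)" "v \<in> hanoi_configs p (Suc m)"
      "legal_move p (Suc m) u v \<or> legal_move p (Suc m) v u" "u (Suc m) = 1" "v (Suc m) \<noteq> 1"
      by (auto simp: edge_boundary_def hanoi_graph_def top_set_def)
    define l where "l = v (Suc m)"
    have l: "l \<in> {2..p}" using uv(2,5) by (force simp: l_def hanoi_configs_def PiE_iff)
    have ne: "u (Suc m) \<noteq> v (Suc m)" "v (Suc m) \<noteq> u (Suc m)" using uv(4,5) by simp_all
    \<comment> \<open>An arc may come from a legal move in either direction; both cases give the
      same form since \<open>avoiding\<close> is symmetric in the pegs.\<close>
    from uv(3) have "\<exists>\<sigma>\<in>avoiding p m 1 l. u = \<sigma>(Suc m := 1) \<and> v = \<sigma>(Suc m := l)"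
    proof
      assume "legal_move p (Suc m) u v"
      note D = legal_move_largestD[OF this ne(1) uv(1), unfolded uv(4), folded l_def]
      show ?thesis
      proof (intro bexI[of _ "u(Suc m := undefined)"] conjI)
        show "u = (u(Suc m := undefined))(Suc m := 1)" using uv(4) by (simp add: fun_upd_idem)
        show "v = (u(Suc m := undefined))(Suc m := l)" unfolding fun_upd_upd by (rule D(2))
        show "u(Suc m := undefined) \<in> avoiding p m 1 l" by (rule D(1))
      qed
    next
      assume "legal_move p (Suc m) v u"
      note D = legal_move_largestD[OF this ne(2) uv(2), unfolded uv(4), folded l_def]
      show ?thesis
      proof (intro bexI[of _ "v(Suc m := undefined)"] conjI)
        show "u = (v(Suc m := undefined))(Suc m := 1)" unfolding fun_upd_upd by (rule D(2))
        show "v = (v(Suc m := undefined))(Suc m := l)" by (simp add: l_def)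
        show "v(Suc m := undefined) \<in> avoiding p m 1 l"
          using D(1) by (simp only: avoiding_commute)
      qed
    qed
    then show "x \<in> \<psi> ` A" using l by (force simp: A_def \<psi>_def x)
  qed
  then have "cut p (Suc m) (top_set m) \<le> card A"
    unfolding cut_def by (rule surj_card_le[rotated]) (simp add: A_def)
  also have "\<dots> = (\<Sum>l\<in>{2..p}. card (avoiding p m 1 l))"
    by (simp add: A_def)
  also have "\<dots> = (\<Sum>l\<in>{2..p}. (p - 2) ^ m)"
    using p3 by (intro sum.cong refl card_avoiding) auto
  finally show ?thesis by simp
qed

text \<open>The lower bound holds for every admissible set by \<open>cut_ge\<close>, the upper one
  is witnessed by \<open>top_set\<close>. At least one disc is present: a single vertex has no
  admissible set, and \<open>Min\<close> would be taken over the empty set.\<close>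

lemma edge_expansion_bounds:
  shows "1 / (2 * expansion_const) * ratio ^ Suc m \<le> edge_expansion (hanoi_graph p (Suc m))"
    and "edge_expansion (hanoi_graph p (Suc m)) \<le> (real p - 1) / ratio * ratio ^ Suc m"
proof -
  define X where "X = {real (card (edge_boundary (hanoi_graph p (Suc m)) S)) / real (card S) | S.
            S \<subseteq> pverts (hanoi_graph p (Suc m)) \<and> 0 < card S
            \<and> real (card S) \<le> real (card (pverts (hanoi_graph p (Suc m)))) / 2}"
  have X: "edge_expansion (hanoi_graph p (Suc m)) = Min X"
    by (simp add: X_def edge_expansion_def)
  have verts: "pverts (hanoi_graph p (Suc m)) = hanoi_configs p (Suc m)"
    by (simp add: hanoi_graph_def)
  have "X \<subseteq> (\<lambda>S. real (card (edge_boundary (hanoi_graph p (Suc m)) S)) / real (card S))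
      ` Pow (hanoi_configs p (Suc m))"
    unfolding X_def verts by auto
  then have fin: "finite X" by (rule finite_subset) simp
  have top: "real (cut p (Suc m) (top_set m)) / real (card (top_set m)) \<in> X"
    unfolding X_def verts cut_def
  proof (intro CollectI exI conjI)
    show "real (card (top_set m)) \<le> real (card (hanoi_configs p (Suc m))) / 2"
      using p3 by (simp add: card_top_set card_hanoi_configs)
    show "top_set m \<subseteq> hanoi_configs p (Suc m)" by (auto simp: top_set_def)
    show "0 < card (top_set m)" using p3 by (simp add: card_top_set)
  qed simp
  have "1 / (2 * expansion_const) * ratio ^ Suc m \<le> x" if "x \<in> X" for x
  proof -
    from that obtain S where S: "x = real (cut p (Suc m) S) / real (card S)"
      "S \<subseteq> hanoi_configs p (Suc m)" "0 < card S"
      "real (card S) \<le> real (card (hanoi_configs p (Suc m))) / 2"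
      unfolding X_def verts cut_def by blast
    show ?thesis
      using cut_ge[OF S(2,4)] S(3) expansion_const_pos unfolding S(1) by (simp add: field_simps)
  qed
  then show "1 / (2 * expansion_const) * ratio ^ Suc m \<le> edge_expansion (hanoi_graph p (Suc m))"
    unfolding X using fin top by (subst Min_ge_iff) auto
  have "edge_expansion (hanoi_graph p (Suc m)) \<le> real (cut p (Suc m) (top_set m)) / real (card (top_set m))"
    unfolding X by (rule Min_le[OF fin top])
  also have "\<dots> \<le> real ((p - 1) * (p - 2) ^ m) / real (p ^ m)"
    unfolding card_top_set by (intro divide_right_mono of_nat_mono cut_top_set) simp
  also have "\<dots> = (real p - 1) * ratio ^ m"
    using p3 by (simp add: ratio_def power_divide of_nat_diff)
  \<comment> \<open>Only the \<open>m\<close> smaller discs are constrained in the cut, so passing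
    to the exponent \<open>Suc m\<close> costs a factor \<open>1 / ratio\<close>.\<close>
  also have "\<dots> = (real p - 1) / ratio * ratio ^ Suc m"
    using p3 by (simp add: ratio_def)
  finally show "edge_expansion (hanoi_graph p (Suc m)) \<le> (real p - 1) / ratio * ratio ^ Suc m" .
qed

end

theorem theorem1:
  fixes p :: nat
  assumes "p \<ge> 3"
  shows "(\<lambda>n. edge_expansion (hanoi_graph p n)) \<in> \<Theta>(\<lambda>n. ((real p - 2) / real p) ^ n)"
proof -
  interpret pegs p by unfold_locales (rule assms)
  have ratio: "ratio > 0" using assms by (simp add: ratio_def)
  show ?thesis
    unfolding ratio_def[symmetric]
  proof (rule bigthetaI'[of "1 / (2 * expansion_const)" "(real p - 1) / ratio"])
    show "\<forall>\<^sub>F n in at_top. 1 / (2 * expansion_const) * norm (ratio ^ n)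
          \<le> norm (edge_expansion (hanoi_graph p n))
        \<and> norm (edge_expansion (hanoi_graph p n)) \<le> (real p - 1) / ratio * norm (ratio ^ n)"
      using eventually_gt_at_top[of "0::nat"]
    proof eventually_elim
      case (elim n)
      then obtain m where n: "n = Suc m" by (cases n) auto
      have "1 / (2 * expansion_const) * ratio ^ Suc m \<ge> 0"
        using ratio expansion_const_pos by simp
      then have "norm (edge_expansion (hanoi_graph p n)) = edge_expansion (hanoi_graph p n)"
        using edge_expansion_bounds(1)[of m] unfolding n by simp
      moreover have "norm (ratio ^ n) = ratio ^ n"
        using ratio by simp
      ultimately show ?case
        using edge_expansion_bounds[of m] unfolding n by metis
    qed
  qed (use ratio expansion_const_pos assms in auto)
qed

end
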